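(* Let $A,M$ be vector spaces and let $\mu\in\mathrm{Hom}(A^{\otimes2},A)$, $l_M\in\mathrm{Hom}(A\otimes M,M)$, $r_M\in\mathrm{Hom}(M\otimes A,M)$, $P\in\mathrm{Hom}(M,A)$ be linear maps. Let $\Delta\in\mathfrak h_1$ be the element defined from $\mu,l_M,r_M$ in the context. Then $(A,\mu)$ is an associative algebra, $(M,l_M,r_M)$ is an $(A,\mu)$-bimodule (with left action $l_M$ and right action $r_M$) and $P:M\to A$ is a relative averaging operator if and only if $\alpha=(s^{-1}\Delta,P)\in(s^{-1}\mathfrak h\oplus\mathfrak a)_0$ is a Maurer-Cartan element of the $L_\infty$-algebra $(s^{-1}\mathfrak h\oplus\mathfrak a,\{l_k\}_{k=1}^\infty)$ described in the context.
   Context: Everything is over a field $\mathbf k$ of characteristic $0$. Relative averaging operator: for an associative algebra $A$ and an $A$-bimodule $M$, a linear map $P:M\to A$ with $P(u)\cdot P(v)=P(P(u)\cdot_M v)=P(u\cdot_M P(v))$ for all $u,v\in M$ ($\cdot_M$ denotes both actions). Trees. $Y_n$ ($n\ge 1$) is the set of planar binary trees with $n$ trivalent vertices, one root and $n+1$ leaves labelled $0,1,\dots,n$ from left to right; $\vee$ is grafting at a new root vertex, $Y_1=\{|\vee|\}$, $Y_2=\{y_\dashv,y_\vdash\}$ with $y_\dashv=|\vee(|\vee|)$, $y_\vdash=(|\vee|)\vee|$. For $m,n\ge1$, $1\le i\le m$: $R_0^{m;i,n}:Y_{m+n-1}\to Y_m$ deletes the leaves labelled $i,\dots,i+n-2$,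 and $R_i^{m;i,n}:Y_{m+n-1}\to Y_n$ deletes the leaves labelled $0,\dots,i-2$ and $i+n,\dots,m+n-1$ (labels refer to the original tree). Majumdar-Mukherjee bracket. For a vector space $D$ put $CY^n(D,D)=\mathrm{Hom}(\mathbf k[Y_n]\otimes D^{\otimes n},D)$. For $f\in CY^m(D,D)$, $g\in CY^n(D,D)$, $m,n\geq 1$, $$(f\circ_i g)(y;a_1,\dots,a_{m+n-1})=f\big(R_0^{m;i,n}(y);a_1,\dots,a_{i-1},g(R_i^{m;i,n}(y);a_i,\dots,a_{i+n-1}),a_{i+n},\dots,a_{m+n-1}\big),$$ $$[f,g]_{\mathsf{MM}}=\sum_{i=1}^m(-1)^{(i-1)(n-1)}f\circ_i g-(-1)^{(m-1)(n-1)}\sum_{i=1}^n(-1)^{(i-1)(m-1)}g\circ_i f ,$$ a graded Lie bracket on $\oplus_{n\ge0}CY^{n+1}(D,D)$ with $CY^{n+1}(D,D)$ in degree $n$. Let $\mathfrak g=\oplus_{n\ge0}CY^{n+1}(A\oplus M,A\oplus M)$. Let $\mathcal A^{k,l}\subset(A\oplus M)^{\otimes(k+l)}$ be the direct sum of all tensor products of $k$ copies of $A$ and $l$ copies of $M$, in any order. $f\in CY^{n+1}(A\oplus M,A\oplus M)$ has bidegree $k|l$, $k+l=n$, if $f(\mathbf k[Y_{n+1}]\otimes\mathcal A^{k+1,l})\subset A$, $f(\mathbf k[Y_{n+1}]\otimes\mathcal A^{k,l+1})\subset M$ and $f=0$ otherwise; $CY^{k|l}$ is the space of these. $\mathfrak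 h=\oplus_{n\ge0}\mathfrak h_n$ with $\mathfrak h_n=CY^{n|0}$, and $\mathfrak a=\oplus_{n\ge0}\mathfrak a_n$ with $\mathfrak a_n=CY^{-1|n+1}\cong\mathrm{Hom}(\mathbf k[Y_{n+1}]\otimes M^{\otimes n+1},A)$. $p:\mathfrak g\to\mathfrak g$ is the projection onto $\mathfrak a$ (component with all inputs in $M$ and output in $A$). $(s^{-1}\mathfrak h)_k=\mathfrak h_{k+1}$. The $L_\infty$-algebra $s^{-1}\mathfrak h\oplus\mathfrak a$ (in the convention of degree $1$ graded symmetric operations $l_k$) has $l_2((s^{-1}f,0),(s^{-1}g,0))=((-1)^{|f|}s^{-1}[f,g]_{\mathsf{MM}},0)$ and $l_k((s^{-1}f,0),(0,h_1),\dots,(0,h_{k-1}))=(0,p[\cdots[[f,h_1]_{\mathsf{MM}},h_2]_{\mathsf{MM}},\dots,h_{k-1}]_{\mathsf{MM}})$ for $k\ge2$, all other maps being zero up to permutation of the entries. A Maurer-Cartan element of an $L_\infty$-algebra $(L,\{l_k\})$ is $\alpha\in L_0$ with $\sum_{k\ge1}\frac1{k!}l_k(\alpha,\dots,\alpha)=0$. $\Delta\in\mathfrak h_1$ is given by $\Delta(y_\dashv;(a,u),(b,v))=(\mu(a,b),r_M(u,b))$ and $\Delta(y_\vdash;(a,u),(b,v))=(\mu(a,b),l_M(a,v))$; it gives $s^{-1}\Delta\in(s^{-1}\mathfrak h)_0$. $P\in\mathrm{Hom}(M,A)$ is viewed in $\mathfrak a_0$ via $P(|\vee|;u)=P(u)$.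 *)

theory Defs
  imports "HOL-Analysis.Product_Vector" "HOL-Library.Function_Algebras"
begin

section \<open>Planar binary trees\<close>

datatype ptree = Leaf | Graft ptree ptree  (infixl \<open>\<or>\<^sub>t\<close> 65)

primrec vertices :: "ptree \<Rightarrow> nat" where
  "vertices Leaf = 0"
| "vertices (s \<or>\<^sub>t t) = vertices s + vertices t + 1"

definition Y :: "nat \<Rightarrow> ptree set" where
  "Y n = {t. vertices t = n}"

text \<open>\<open>prune S k t\<close>: the leaves of \<open>t\<close> are labelled \<open>k, k+1, \<dots>\<close> from left to right, and
  those with label in \<open>S\<close> are removed; a vertex that loses one of its branches disappears together
  with it. The result is \<open>None\<close> if no leaf survives. A tree with \<open>n\<close> vertices has \<open>n + 1\<close> leaves,
  hence the offset for the right branch.\<close>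

primrec prune :: "nat set \<Rightarrow> nat \<Rightarrow> ptree \<Rightarrow> ptree option" where
  "prune S k Leaf = (if k \<in> S then None else Some Leaf)"
| "prune S k (s \<or>\<^sub>t t) =
    (case prune S k s of
       None \<Rightarrow> prune S (k + vertices s + 1) t
     | Some s' \<Rightarrow>
         (case prune S (k + vertices s + 1) t of
            None \<Rightarrow> Some s'
          | Some t' \<Rightarrow> Some (s' \<or>\<^sub>t t')))"

definition delete_leaves :: "nat set \<Rightarrow> ptree \<Rightarrow> ptree" where
  "delete_leaves S t = the (prune S 0 t)"

definition R_outer :: "nat \<Rightarrow> nat \<Rightarrow> nat \<Rightarrow> ptree \<Rightarrow> ptree" where
  "R_outer m i n = delete_leaves {l. i \<le> l \<and> l + 2 \<le> i + n}"

definition R_inner :: "nat \<Rightarrow> nat \<Rightarrow> nat \<Rightarrow> ptree \<Rightarrow> ptree" where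
  "R_inner m i n = delete_leaves ({l. l + 2 \<le> i} \<union> {i + n .. m + n - 1})"


section \<open>Cochains and the Majumdar--Mukherjee bracket\<close>

text \<open>\<open>Hom(k[Y n] \<otimes> D^{\<otimes>n}, D)\<close> is encoded by functions of a tree and of a list of \<open>n\<close> arguments,
  multilinear in the list for every tree in \<open>Y n\<close> and set to \<open>0\<close> off the relevant trees and lists.\<close>

type_synonym 'd cochain = "ptree \<Rightarrow> 'd list \<Rightarrow> 'd"

definition CY :: "('k::field \<Rightarrow> 'd::ab_group_add \<Rightarrow> 'd) \<Rightarrow> nat \<Rightarrow> 'd cochain set" where
  "CY s n = {f.
     (\<forall>y xs. y \<notin> Y n \<or> length xs \<noteq> n \<longrightarrow> f y xs = 0) \<and>
     (\<forall>y\<in>Y n. \<forall>xs. \<forall>j<n. length xs = n \<longrightarrow>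
        Vector_Spaces.linear s s (\<lambda>v. f y (xs[j := v])))}"

definition circ :: "nat \<Rightarrow> nat \<Rightarrow> nat \<Rightarrow> 'd::ab_group_add cochain \<Rightarrow> 'd cochain \<Rightarrow> 'd cochain" where
  "circ m n i f g = (\<lambda>y as.
     if y \<in> Y (m + n - 1) \<and> length as = m + n - 1
     then f (R_outer m i n y)
            (take (i - 1) as @ [g (R_inner m i n y) (take n (drop (i - 1) as))]
               @ drop (i - 1 + n) as)
     else 0)"

definition sgn_pow :: "nat \<Rightarrow> 'c::ab_group_add \<Rightarrow> 'c" where
  "sgn_pow e c = (if even e then c else - c)"

definition MM :: "nat \<Rightarrow> nat \<Rightarrow> 'd::ab_group_add cochain \<Rightarrow> 'd cochain \<Rightarrow> 'd cochain" where
  "MM m n f g =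
     (\<Sum>i = 1..m. sgn_pow ((i - 1) * (n - 1)) (circ m n i f g))
     - sgn_pow ((m - 1) * (n - 1)) (\<Sum>i = 1..n. sgn_pow ((i - 1) * (m - 1)) (circ n m i g f))"

text \<open>An element of the direct sum of the \<open>CY^{n+1}\<close> (\<open>n \<ge> 0\<close>) is encoded by the sequence of its
  components, the \<open>n\<close>-th one, of degree \<open>n\<close>, having \<open>n + 1\<close> arguments.\<close>

type_synonym 'd graded = "nat \<Rightarrow> 'd cochain"

definition single :: "nat \<Rightarrow> 'd::ab_group_add cochain \<Rightarrow> 'd graded" where
  "single n f = (\<lambda>j. if j = n then f else 0)"

definition bracket :: "'d::ab_group_add graded \<Rightarrow> 'd graded \<Rightarrow> 'd graded" where
  "bracket x y = (\<lambda>d. \<Sum>m\<le>d. MM (m + 1) (d - m + 1) (x m) (y (d - m)))"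


section \<open>Bidegrees\<close>

text \<open>\<open>mixed k l\<close> consists of the lists representing the pure tensors that span
  \<open>\<A>^{k,l}\<close>; the Boolean list records which factors lie in \<open>A\<close>. For multilinear maps, conditions on
  \<open>\<A>^{k,l}\<close> can be tested on these. \<open>k\<close> and \<open>l\<close> are integers because bidegrees may
  contain \<open>-1\<close>; with a negative index \<open>mixed k l\<close> is empty.\<close>

definition mixed :: "int \<Rightarrow> int \<Rightarrow> ('a::zero \<times> 'b::zero) list set" where
  "mixed k l = {xs. \<exists>bs. int (count_list bs True) = k \<and> int (count_list bs False) = l \<and>
     list_all2 (\<lambda>b x. if b then snd x = 0 else fst x = 0) bs xs}"

definition CY_bidegree ::
  "('k::field \<Rightarrow> 'a::ab_group_add \<Rightarrow> 'a) \<Rightarrow> ('k \<Rightarrow> 'b::ab_group_add \<Rightarrow> 'b) \<Rightarrow> int \<Rightarrow> int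
     \<Rightarrow> ('a \<times> 'b) cochain set" where
  "CY_bidegree sA sM k l = {f \<in> CY (module_prod.scale sA sM) (nat (k + l + 1)).
     (\<forall>y. \<forall>xs\<in>mixed (k + 1) l. snd (f y xs) = 0) \<and>
     (\<forall>y. \<forall>xs\<in>mixed k (l + 1). fst (f y xs) = 0) \<and>
     (\<forall>k' l'. k' + l' = k + l + 1 \<longrightarrow> (k', l') \<noteq> (k + 1, l) \<longrightarrow> (k', l') \<noteq> (k, l + 1) \<longrightarrow>
        (\<forall>y. \<forall>xs\<in>mixed k' l'. f y xs = 0))}"

definition h_space ::
  "('k::field \<Rightarrow> 'a::ab_group_add \<Rightarrow> 'a) \<Rightarrow> ('k \<Rightarrow> 'b::ab_group_add \<Rightarrow> 'b) \<Rightarrow> nat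
     \<Rightarrow> ('a \<times> 'b) cochain set" where
  "h_space sA sM n = CY_bidegree sA sM (int n) 0"

definition a_space ::
  "('k::field \<Rightarrow> 'a::ab_group_add \<Rightarrow> 'a) \<Rightarrow> ('k \<Rightarrow> 'b::ab_group_add \<Rightarrow> 'b) \<Rightarrow> nat
     \<Rightarrow> ('a \<times> 'b) cochain set" where
  "a_space sA sM n = CY_bidegree sA sM (-1) (int n + 1)"

definition proj_a :: "('a::zero \<times> 'b::zero) graded \<Rightarrow> ('a \<times> 'b) graded" where
  "proj_a x = (\<lambda>n y as. (fst (x n y (map (\<lambda>v. (0, snd v)) as)), 0))"


section \<open>The operations on \<open>s\<^sup>-\<^sup>1\<hh> \<oplus> \<aa>\<close>\<close>

text \<open>The pair \<open>(x, h)\<close> stands for \<open>(s^{-1} x, h)\<close>. The component \<open>x n\<close> lies in \<open>\<hh>\<^sub>n\<close> and thus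
  contributes in degree \<open>n - 1\<close>, whereas \<open>h n\<close> lies in \<open>\<aa>\<^sub>n\<close> and contributes in degree \<open>n\<close>.\<close>

type_synonym ('a, 'b) shifted_sum = "('a \<times> 'b) graded \<times> ('a \<times> 'b) graded"

definition L_space ::
  "('k::field \<Rightarrow> 'a::ab_group_add \<Rightarrow> 'a) \<Rightarrow> ('k \<Rightarrow> 'b::ab_group_add \<Rightarrow> 'b) \<Rightarrow> int
     \<Rightarrow> ('a, 'b) shifted_sum set" where
  "L_space sA sM d = {(x, h).
     (\<forall>n. x n \<in> h_space sA sM n) \<and> (\<forall>n. int n - 1 \<noteq> d \<longrightarrow> x n = 0) \<and>
     (\<forall>n. h n \<in> a_space sA sM n) \<and> (\<forall>n. int n \<noteq> d \<longrightarrow> h n = 0)}"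

definition L_scale ::
  "('k::field \<Rightarrow> 'a::ab_group_add \<Rightarrow> 'a) \<Rightarrow> ('k \<Rightarrow> 'b::ab_group_add \<Rightarrow> 'b) \<Rightarrow> 'k
     \<Rightarrow> ('a, 'b) shifted_sum \<Rightarrow> ('a, 'b) shifted_sum" where
  "L_scale sA sM c v =
     ((\<lambda>n y as. module_prod.scale sA sM c (fst v n y as)),
      (\<lambda>n y as. module_prod.scale sA sM c (snd v n y as)))"

definition twist :: "nat \<Rightarrow> 'd::ab_group_add graded \<Rightarrow> 'd graded" where
  "twist e x = (\<lambda>n. sgn_pow (e * n) (x n))"

text \<open>The multilinear graded symmetric extension of the two formulas for \<open>l\<^sub>k\<close>.

  In the \<open>\<hh>\<close>-component only \<open>k = 2\<close> occurs, and \<open>twist 1\<close> multiplies the degree \<open>m\<close>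
  part of the first entry by \<open>(-1)^m\<close>.

  In the \<open>\<aa>\<close>-component exactly one entry contributes with its \<open>s\<^sup>-\<^sup>1\<hh>\<close>-part, and \<open>j\<close> is its position.
  Moving its component of \<open>\<hh>\<close>-degree \<open>m\<close>, which has degree \<open>m - 1\<close> in \<open>s\<^sup>-\<^sup>1\<hh>\<close>, to the front past
  the \<open>\<aa>\<close>-parts of the entries before it produces the Koszul sign \<open>(-1)^{(m-1)n}\<close> for
  each component of degree \<open>n\<close> passed; \<open>m + 1\<close> has the same parity as \<open>m - 1\<close>.\<close>

definition linf :: "nat \<Rightarrow> ('a::ab_group_add, 'b::ab_group_add) shifted_sum list
    \<Rightarrow> ('a, 'b) shifted_sum" where
  "linf k vs = (if k \<ge> 2 \<and> length vs = k then
     (if k = 2 then bracket (twist 1 (fst (vs ! 0))) (fst (vs ! 1)) else 0,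
      \<Sum>j<k. \<Sum>m | fst (vs ! j) m \<noteq> 0.
        proj_a (foldl bracket (single m (fst (vs ! j) m))
          (map (\<lambda>v. twist (m + 1) (snd v)) (take j vs) @ map snd (drop (Suc j) vs))))
     else 0)"

text \<open>The space carries no topology, so the Maurer--Cartan series is required to be a finite sum.\<close>

definition maurer_cartan ::
  "('k::field_char_0 \<Rightarrow> 'l::ab_group_add \<Rightarrow> 'l) \<Rightarrow> (int \<Rightarrow> 'l set) \<Rightarrow> (nat \<Rightarrow> 'l list \<Rightarrow> 'l)
     \<Rightarrow> 'l \<Rightarrow> bool" where
  "maurer_cartan s L l \<alpha> \<longleftrightarrow>
     \<alpha> \<in> L 0 \<and>
     finite {k. 1 \<le> k \<and> l k (replicate k \<alpha>) \<noteq> 0} \<and>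
     (\<Sum>k | 1 \<le> k \<and> l k (replicate k \<alpha>) \<noteq> 0. s (1 / fact k) (l k (replicate k \<alpha>))) = 0"


section \<open>Algebras, bimodules and relative averaging operators\<close>

definition bilinear_map ::
  "('k::field \<Rightarrow> 'a::ab_group_add \<Rightarrow> 'a) \<Rightarrow> ('k \<Rightarrow> 'b::ab_group_add \<Rightarrow> 'b)
     \<Rightarrow> ('k \<Rightarrow> 'c::ab_group_add \<Rightarrow> 'c) \<Rightarrow> ('a \<Rightarrow> 'b \<Rightarrow> 'c) \<Rightarrow> bool" where
  "bilinear_map s1 s2 s3 f \<longleftrightarrow>
     (\<forall>x. Vector_Spaces.linear s2 s3 (f x)) \<and> (\<forall>y. Vector_Spaces.linear s1 s3 (\<lambda>x. f x y))"

definition assoc_algebra ::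
  "('k::field \<Rightarrow> 'a::ab_group_add \<Rightarrow> 'a) \<Rightarrow> ('a \<Rightarrow> 'a \<Rightarrow> 'a) \<Rightarrow> bool" where
  "assoc_algebra sA \<mu> \<longleftrightarrow>
     bilinear_map sA sA sA \<mu> \<and> (\<forall>a b c. \<mu> (\<mu> a b) c = \<mu> a (\<mu> b c))"

definition bimodule ::
  "('k::field \<Rightarrow> 'a::ab_group_add \<Rightarrow> 'a) \<Rightarrow> ('a \<Rightarrow> 'a \<Rightarrow> 'a) \<Rightarrow>
     ('k \<Rightarrow> 'b::ab_group_add \<Rightarrow> 'b) \<Rightarrow> ('a \<Rightarrow> 'b \<Rightarrow> 'b) \<Rightarrow> ('b \<Rightarrow> 'a \<Rightarrow> 'b) \<Rightarrow> bool" where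
  "bimodule sA \<mu> sM l r \<longleftrightarrow>
     bilinear_map sA sM sM l \<and> bilinear_map sM sA sM r \<and>
     (\<forall>a b u. l (\<mu> a b) u = l a (l b u)) \<and>
     (\<forall>a u b. r (l a u) b = l a (r u b)) \<and>
     (\<forall>u a b. r (r u a) b = r u (\<mu> a b))"

definition rel_averaging ::
  "('k::field \<Rightarrow> 'a::ab_group_add \<Rightarrow> 'a) \<Rightarrow> ('a \<Rightarrow> 'a \<Rightarrow> 'a) \<Rightarrow>
     ('k \<Rightarrow> 'b::ab_group_add \<Rightarrow> 'b) \<Rightarrow> ('a \<Rightarrow> 'b \<Rightarrow> 'b) \<Rightarrow> ('b \<Rightarrow> 'a \<Rightarrow> 'b) \<Rightarrow> ('b \<Rightarrow> 'a) \<Rightarrow> bool" where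
  "rel_averaging sA \<mu> sM l r P \<longleftrightarrow>
     Vector_Spaces.linear sM sA P \<and>
     (\<forall>u v. \<mu> (P u) (P v) = P (l (P u) v) \<and> P (l (P u) v) = P (r u (P v)))"

definition Delta ::
  "('a::ab_group_add \<Rightarrow> 'a \<Rightarrow> 'a) \<Rightarrow> ('a \<Rightarrow> 'b::ab_group_add \<Rightarrow> 'b) \<Rightarrow> ('b \<Rightarrow> 'a \<Rightarrow> 'b)
     \<Rightarrow> ('a \<times> 'b) cochain" where
  "Delta \<mu> l r = (\<lambda>y xs. case xs of
       [(a, u), (b, v)] \<Rightarrow>
         if y = Leaf \<or>\<^sub>t (Leaf \<or>\<^sub>t Leaf) then (\<mu> a b, r u b)
         else if y = (Leaf \<or>\<^sub>t Leaf) \<or>\<^sub>t Leaf then (\<mu> a b, l a v)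
         else 0
     | _ \<Rightarrow> 0)"

definition P_cochain :: "('b::ab_group_add \<Rightarrow> 'a::ab_group_add) \<Rightarrow> ('a \<times> 'b) cochain" where
  "P_cochain P = (\<lambda>y xs. case xs of
       [(a, u)] \<Rightarrow> if y = Leaf \<or>\<^sub>t Leaf then (P u, 0) else 0
     | _ \<Rightarrow> 0)"

end

theory Submission
  imports Defs
begin

text \<open>Since \<open>\<Delta>\<close> has bidegree \<open>1|0\<close> and \<open>P\<close> has bidegree \<open>-1|1\<close>, the iterated bracket
  \<open>[\<cdots>[\<Delta>, P], \<cdots>, P]\<close> with \<open>k\<close> copies of \<open>P\<close> has bidegree \<open>1-k|k\<close>; it meets \<open>\<aa>\<close> only for \<open>k = 2\<close>
  and vanishes for \<open>k \<ge> 3\<close>. The Maurer--Cartan equation therefore splits into \<open>[\<Delta>, \<Delta>] = 0\<close> and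
  \<open>[[\<Delta>, P], P] = 0\<close>. Evaluated at the five trees of \<open>Y 3\<close>, the first one gives associativity
  of \<open>\<mu>\<close> and the bimodule axioms; the two trees of \<open>Y 2\<close> turn the second one into twice the two
  averaging identities.\<close>

section \<open>Small trees\<close>

lemma vertices_eq_0_iff: "vertices t = 0 \<longleftrightarrow> t = Leaf"
  by (cases t) auto

lemma Y_0: "Y 0 = {Leaf}"
  by (auto simp: Y_def vertices_eq_0_iff)

text \<open>A tree with a vertex is split at its root, and the branches share the other
  \<open>n\<close> vertices. This recursion enumerates the small sets of trees on which the bracket
  equations are tested.\<close>

lemma Y_Suc: "Y (Suc n) = (\<Union>k\<le>n. {s \<or>\<^sub>t t | s t. s \<in> Y k \<and> t \<in> Y (n - k)})" (is "_ = ?R")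
proof (intro set_eqI iffI)
  fix y assume "y \<in> Y (Suc n)"
  then obtain s t where "y = s \<or>\<^sub>t t" "vertices s + vertices t = n"
    by (cases y) (auto simp: Y_def)
  then show "y \<in> ?R" by (force simp: Y_def)
qed (auto simp: Y_def)

abbreviation (input) cherry :: ptree where "cherry \<equiv> Leaf \<or>\<^sub>t Leaf"

lemma Y_1: "Y (Suc 0) = {cherry}"
  by (auto simp: Y_Suc Y_0)

lemma Y_2: "Y 2 = {Leaf \<or>\<^sub>t cherry, cherry \<or>\<^sub>t Leaf}"
  by (auto simp: numeral_2_eq_2 Y_Suc Y_1 Y_0 le_Suc_eq)

lemma Y_3: "Y 3 = {Leaf \<or>\<^sub>t (Leaf \<or>\<^sub>t cherry), Leaf \<or>\<^sub>t (cherry \<or>\<^sub>t Leaf), cherry \<or>\<^sub>t cherry,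
    (Leaf \<or>\<^sub>t cherry) \<or>\<^sub>t Leaf, (cherry \<or>\<^sub>t Leaf) \<or>\<^sub>t Leaf}"
proof -
  have "Y 3 = (\<Union>k\<in>{0, 1, 2}. {s \<or>\<^sub>t t | s t. s \<in> Y k \<and> t \<in> Y (2 - k)})"
    unfolding numeral_3_eq_3 numeral_2_eq_2 Y_Suc by (intro arg_cong2[of _ _ _ _ "\<lambda>A f. \<Union> (f ` A)"]) auto
  then show ?thesis by (auto simp: Y_0 Y_1 Y_2)
qed

lemmas tree_simps = R_outer_def R_inner_def delete_leaves_def

section \<open>Brackets with a vanishing entry\<close>

lemma sgn_pow_0 [simp]: "sgn_pow e 0 = 0"
  by (simp add: sgn_pow_def)

lemma sgn_pow_even [simp]: "sgn_pow 0 c = c"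
  by (simp add: sgn_pow_def)

lemma sgn_pow_apply: "sgn_pow e f y xs = sgn_pow e (f y xs)"
  by (simp add: sgn_pow_def fun_Compl_def)

lemma sum_apply2: "(\<Sum>i\<in>A. f i) y xs = (\<Sum>i\<in>A. f i y xs)"
  by (induction A rule: infinite_finite_induct) auto

text \<open>The trace of multilinearity that the bracket calculations use. It passes to
  \<open>circ\<close> and \<open>MM\<close> without tracking membership in \<open>CY\<close>, and it
  makes a bracket with a zero cochain vanish.\<close>

definition zero_absorbing :: "'d::ab_group_add cochain \<Rightarrow> bool" where
  "zero_absorbing f \<longleftrightarrow> (\<forall>y xs. 0 \<in> set xs \<longrightarrow> f y xs = 0)"

lemma zero_absorbingD: "zero_absorbing f \<Longrightarrow> 0 \<in> set xs \<Longrightarrow> f y xs = 0"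
  by (simp add: zero_absorbing_def)

lemma zero_absorbing_0: "zero_absorbing 0"
  by (simp add: zero_absorbing_def)

text \<open>The argument list is cut into three blocks. A zero in the middle block makes
  \<open>g\<close> vanish, so in every case \<open>f\<close> receives a zero argument.\<close>

lemma zero_absorbing_circ:
  assumes "zero_absorbing f" "zero_absorbing g"
  shows "zero_absorbing (circ m n i f g)"
  unfolding zero_absorbing_def
proof (intro allI impI)
  fix y and as :: "'a list"
  assume z: "0 \<in> set as"
  let ?a = "take (i - 1) as" and ?b = "take n (drop (i - 1) as)" and ?c = "drop (i - 1 + n) as"
  have "as = ?a @ ?b @ ?c"
    by (metis add.commute append_take_drop_id drop_drop)
  with z have "0 \<in> set ?a \<or> 0 \<in> set ?b \<or> 0 \<in> set ?c"
    by (metis Un_iff set_append)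
  then show "circ m n i f g y as = 0"
    using assms by (auto simp: circ_def intro!: zero_absorbingD)
qed

lemma zero_absorbing_MM:
  assumes "zero_absorbing f" "zero_absorbing g"
  shows "zero_absorbing (MM m n f g)"
  using zero_absorbing_circ[OF assms] zero_absorbing_circ[OF assms(2,1)]
  by (simp add: zero_absorbing_def MM_def sum_apply2 sgn_pow_apply)

lemma circ_zero_left: "circ m n i 0 g = 0"
  by (auto simp: circ_def fun_eq_iff)

lemma circ_zero_right: "zero_absorbing f \<Longrightarrow> circ m n i f 0 = 0"
  by (auto simp: circ_def fun_eq_iff intro!: zero_absorbingD)

lemma MM_zero_left: "zero_absorbing g \<Longrightarrow> MM m n 0 g = 0"
  by (simp add: MM_def circ_zero_left circ_zero_right)

lemma MM_zero_right: "zero_absorbing f \<Longrightarrow> MM m n f 0 = 0"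
  by (simp add: MM_def circ_zero_left circ_zero_right)

section \<open>Brackets of elements concentrated in one degree\<close>

lemma single_0 [simp]: "single n 0 = 0"
  by (auto simp: single_def)

lemma single_same [simp]: "single n f n = f"
  by (simp add: single_def)

lemma bracket_single:
  assumes "zero_absorbing f" "zero_absorbing g"
  shows "bracket (single m f) (single n g) = single (m + n) (MM (m + 1) (n + 1) f g)"
proof
  fix d
  \<comment> \<open>Of all splittings of the degree \<open>d\<close>, only \<open>k = m\<close> with
    \<open>d = m + n\<close> pairs two entries that need not be zero.\<close>
  have "bracket (single m f) (single n g) d
      = (\<Sum>k\<le>d. if k = m \<and> d = m + n then MM (m + 1) (n + 1) f g else 0)"
    unfolding bracket_def
  proof (rule sum.cong[OF refl])
    fix k assume "k \<in> {..d}"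
    then show "MM (k + 1) (d - k + 1) (single m f k) (single n g (d - k))
        = (if k = m \<and> d = m + n then MM (m + 1) (n + 1) f g else 0)"
      using assms by (auto simp: single_def MM_zero_left MM_zero_right zero_absorbing_0)
  qed
  also have "\<dots> = single (m + n) (MM (m + 1) (n + 1) f g) d"
    by (simp add: single_def)
  finally show "bracket (single m f) (single n g) d = single (m + n) (MM (m + 1) (n + 1) f g) d" .
qed

text \<open>Bracketing with an element of degree 0 preserves the degree, so the fold iterates one
  operator with fixed arities.\<close>

lemma foldl_bracket_single:
  assumes "zero_absorbing f" "zero_absorbing g"
  shows "foldl bracket (single m f) (replicate k (single 0 g))
    = single m (((\<lambda>h. MM (m + 1) 1 h g) ^^ k) f)"
  using assms(1)
proof (induction k arbitrary: f)
  case (Suc k)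
  then show ?case
    using assms(2) by (simp add: bracket_single zero_absorbing_MM funpow_Suc_right del: funpow.simps)
qed simp

lemma proj_a_0 [simp]: "proj_a 0 = 0"
  by (simp add: proj_a_def fun_eq_iff zero_prod_def)

section \<open>Brackets in low arity\<close>

lemma length_2_conv: "length xs = 2 \<longleftrightarrow> (\<exists>a b. xs = [a, b])"
  by (auto simp: numeral_2_eq_2 length_Suc_conv)

lemma length_3_conv: "length xs = 3 \<longleftrightarrow> (\<exists>a b c. xs = [a, b, c])"
  by (auto simp: numeral_3_eq_3 length_Suc_conv)

text \<open>All signs are positive because one entry has degree 0. Inserting a unary cochain leaves
  the outer tree unchanged and prunes the inner one to the only tree of \<open>Y 1\<close>; the
  roles are exchanged in the last term.\<close>

lemma MM_2_1:
  "MM 2 (Suc 0) f g y xs = (if y \<in> Y 2 then (case xs of [a, b] \<Rightarrow>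
      f y [g cherry [a], b] + f y [a, g cherry [b]] - g cherry [f y [a, b]] | _ \<Rightarrow> 0) else 0)"
proof (cases "y \<in> Y 2 \<and> length xs = 2")
  case True
  then obtain a b where xs: "xs = [a, b]" by (auto simp: length_2_conv)
  from True consider "y = Leaf \<or>\<^sub>t cherry" | "y = cherry \<or>\<^sub>t Leaf" by (auto simp: Y_2)
  then show ?thesis
    using True unfolding xs
    by cases (auto simp: MM_def circ_def sgn_pow_apply numeral_2_eq_2 tree_simps)
next
  case False
  then show ?thesis
    by (auto simp: MM_def circ_def sum_apply2 sgn_pow_apply numeral_2_eq_2 split: list.splits)
qed

text \<open>The sign on the first entry is the one that \<open>twist 1\<close> produces in degree 1.
  Both halves of the bracket then give \<open>- c\<close>; the hypotheses pull the sign out of the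
  inserted cochain in the second half.\<close>

lemma MM_2_2:
  fixes f :: "'d::ab_group_add cochain"
  assumes "\<And>y a b. f y [- a, b] = - f y [a, b]" "\<And>y a b. f y [a, - b] = - f y [a, b]"
  shows "MM 2 2 (- f) f y xs = (let c = circ 2 2 1 f f y xs - circ 2 2 2 f f y xs in - (c + c))"
proof (cases "y \<in> Y 3 \<and> length xs = 3")
  case True
  then obtain a b c where xs: "xs = [a, b, c]" by (auto simp: length_3_conv)
  show ?thesis
    using True unfolding xs
    by (auto simp: MM_def circ_def sgn_pow_apply sgn_pow_def fun_Compl_def numeral_2_eq_2
        numeral_3_eq_3 assms[unfolded One_nat_def] Let_def)
next
  case False
  then show ?thesis
    by (auto simp: MM_def circ_def sum_apply2 sgn_pow_apply)
qed

section \<open>The operations on a Maurer--Cartan candidate\<close>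

text \<open>Since \<open>g\<close> sits in degree 0, moving the \<open>f\<close>-part to the front
  costs no Koszul sign, and all \<open>k\<close> positions contribute the same term.\<close>

lemma linf_replicate:
  fixes f g :: "('a::ab_group_add \<times> 'b::ab_group_add) cochain"
  assumes "zero_absorbing f" "zero_absorbing g" "k \<ge> 2"
  shows "linf k (replicate k (single 1 f, single 0 g)) =
    (if k = 2 then single 2 (MM 2 2 (- f) f) else 0,
     \<Sum>j<k. proj_a (single 1 (((\<lambda>h. MM 2 (Suc 0) h g) ^^ (k - 1)) f)))"
proof -
  have tw: "twist e (single 0 g) = single 0 g" for e
    by (auto simp: twist_def single_def fun_eq_iff)
  have tw1: "twist 1 (single 1 f) = single 1 (- f)"
    by (auto simp: twist_def single_def sgn_pow_def)
  have neg: "zero_absorbing (- f)"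
    using assms(1) by (simp add: zero_absorbing_def fun_Compl_def)
  let ?T = "\<lambda>f. proj_a (foldl bracket (single 1 f) (replicate (k - 1) (single 0 g)))"
  \<comment> \<open>For \<open>f = 0\<close> the sum over \<open>m\<close> in \<open>linf\<close> is
    empty, so the common term must be seen to vanish.\<close>
  have T0: "?T 0 = 0"
    unfolding foldl_bracket_single[OF zero_absorbing_0 assms(2)]
  proof -
    have "((\<lambda>h. MM (1 + 1) 1 h g) ^^ n) 0 = 0" for n
      by (induction n) (simp_all only: funpow.simps id_apply comp_apply MM_zero_left[OF assms(2)])
    then show "proj_a (single 1 (((\<lambda>h. MM (1 + 1) 1 h g) ^^ (k - 1)) 0)) = 0" by simp
  qed
  have "(\<Sum>m | single 1 f m \<noteq> 0. proj_a (foldl bracket (single m (single 1 f m))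
          (replicate j (single 0 g) @ replicate (k - Suc j) (single 0 g)))) = ?T f"
    if j: "j < k" for j
  proof -
    have "replicate j (single 0 g) @ replicate (k - Suc j) (single 0 g)
        = replicate (k - 1) (single 0 g)"
      using j by (simp flip: replicate_add)
    moreover have "{m. single 1 f m \<noteq> 0} = (if f = 0 then {} else {1})"
      by (auto simp: single_def)
    ultimately show ?thesis
      using T0 by (cases "f = 0") (simp_all del: One_nat_def)
  qed
  then show ?thesis
    using assms(3)
    by (auto simp: linf_def tw tw1[simplified] bracket_single[OF neg assms(1)]
        foldl_bracket_single[OF assms(1,2), of 1, simplified] numeral_2_eq_2 map_replicate_const
        min_def intro!: sum.cong)
qed


section \<open>The Maurer--Cartan equation of \<open>(\<Delta>, P)\<close>\<close>

text \<open>Only the linear structure is fixed; associativity, the bimodule axioms and the averaging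
  identities are to be read off from the Maurer-Cartan equation.\<close>

locale averaging_candidate =
  fixes sA :: "'k::field_char_0 \<Rightarrow> 'a::ab_group_add \<Rightarrow> 'a"
    and sM :: "'k \<Rightarrow> 'b::ab_group_add \<Rightarrow> 'b"
    and \<mu> :: "'a \<Rightarrow> 'a \<Rightarrow> 'a"
    and l :: "'a \<Rightarrow> 'b \<Rightarrow> 'b"
    and r :: "'b \<Rightarrow> 'a \<Rightarrow> 'b"
    and P :: "'b \<Rightarrow> 'a"
  assumes vector_space_A: "vector_space sA" and vector_space_M: "vector_space sM"
    and bilinear_mu: "bilinear_map sA sA sA \<mu>"
    and bilinear_l: "bilinear_map sA sM sM l"
    and bilinear_r: "bilinear_map sM sA sM r"
    and linear_P: "Vector_Spaces.linear sM sA P"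
begin

section \<open>Linear algebra in A, M and their product\<close>

interpretation A: vector_space sA by (fact vector_space_A)
interpretation M: vector_space sM by (fact vector_space_M)

interpretation D: vector_space_prod sA sM ..

abbreviation scaleD :: "'k \<Rightarrow> 'a \<times> 'b \<Rightarrow> 'a \<times> 'b" where
  "scaleD \<equiv> module_prod.scale sA sM"

lemma scaleD: "scaleD c x = (sA c (fst x), sM c (snd x))"
  by (simp add: D.scale_def split: prod.splits)

text \<open>In characteristic 0 the factors 2 and 3 can be cancelled. The 2 arises in both
  [\<Delta>, \<Delta>] and [[\<Delta>, P], P], the 3 from the three positions of \<Delta> in the
  ternary operation.\<close>

lemma A_double: fixes a :: 'a shows "a + a = 0 \<longleftrightarrow> a = 0"
  using A.scale_left_distrib[of 1 1 a] A.scale_eq_0_iff[of 2 a] by simp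

lemma D_double: fixes x :: "'a \<times> 'b" shows "x + x = 0 \<longleftrightarrow> x = 0"
  using D.p.scale_left_distrib[of 1 1 x] D.p.scale_eq_0_iff[of 2 x] by simp

lemma D_triple: fixes x :: "'a \<times> 'b" shows "x + x + x = 0 \<longleftrightarrow> x = 0"
  using D.p.scale_left_distrib[of 1 1 x] D.p.scale_left_distrib[of 2 1 x]
    D.p.scale_eq_0_iff[of 3 x] by simp

lemma linearD_iff: "Vector_Spaces.linear scaleD scaleD f \<longleftrightarrow>
    (\<forall>x y. f (x + y) = f x + f y) \<and> (\<forall>c x. f (scaleD c x) = scaleD c (f x))"
  using D.p.vector_space_axioms
  by (auto simp: Vector_Spaces.linear_iff)

lemmas linear_facts =
  bilinear_mu[unfolded bilinear_map_def Vector_Spaces.linear_iff]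
  bilinear_l[unfolded bilinear_map_def Vector_Spaces.linear_iff]
  bilinear_r[unfolded bilinear_map_def Vector_Spaces.linear_iff]
  linear_P[unfolded Vector_Spaces.linear_iff]

lemma linear_simps [simp]:
  "\<mu> (a + a') b = \<mu> a b + \<mu> a' b" "\<mu> a (b + b') = \<mu> a b + \<mu> a b'"
  "\<mu> (sA c a) b = sA c (\<mu> a b)" "\<mu> a (sA c b) = sA c (\<mu> a b)"
  "l (a + a') u = l a u + l a' u" "l a (u + u') = l a u + l a u'"
  "l (sA c a) u = sM c (l a u)" "l a (sM c u) = sM c (l a u)"
  "r (u + u') a = r u a + r u' a" "r u (a + a') = r u a + r u a'"
  "r (sM c u) a = sM c (r u a)" "r u (sA c a) = sM c (r u a)"
  "P (u + u') = P u + P u'" "P (sM c u) = sA c (P u)"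
  using linear_facts by auto

lemma linear_zeros [simp]:
  "\<mu> 0 b = 0" "\<mu> a 0 = 0" "l 0 u = 0" "l a 0 = 0" "r 0 a = 0" "r u 0 = 0" "P 0 = 0"
  using linear_simps(1)[of 0 0 b] linear_simps(2)[of a 0 0] linear_simps(5)[of 0 0 u]
    linear_simps(6)[of a 0 0] linear_simps(9)[of 0 0 a] linear_simps(10)[of u 0 0]
    linear_simps(13)[of 0 0]
  by simp_all

lemma linear_minus [simp]:
  "\<mu> (- a) b = - \<mu> a b" "\<mu> a (- b) = - \<mu> a b" "l (- a) u = - l a u" "l a (- u) = - l a u"
  "r (- u) a = - r u a" "r u (- a) = - r u a" "P (- u) = - P u"
  by (rule minus_unique[symmetric], simp flip: linear_simps)+

section \<open>The cochains \<Delta> and P\<close>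

abbreviation "\<Delta> \<equiv> Delta \<mu> l r"
abbreviation "\<Pi> \<equiv> P_cochain P"

lemma Delta_eq: "\<Delta> y [x, x'] =
    (if y = Leaf \<or>\<^sub>t cherry then (\<mu> (fst x) (fst x'), r (snd x) (fst x'))
     else if y = cherry \<or>\<^sub>t Leaf then (\<mu> (fst x) (fst x'), l (fst x) (snd x')) else 0)"
  by (cases x; cases x') (simp add: Delta_def)

lemma Delta_outside: "y \<notin> Y 2 \<or> length xs \<noteq> 2 \<Longrightarrow> \<Delta> y xs = 0"
  by (auto simp: Delta_def Y_2 split: list.splits)

lemma P_cochain_eq: "\<Pi> y [x] = (if y = cherry then (P (snd x), 0) else 0)"
  by (cases x) (simp add: P_cochain_def)

lemma P_cochain_outside: "y \<notin> Y 1 \<or> length xs \<noteq> 1 \<Longrightarrow> \<Pi> y xs = 0"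
  by (auto simp: P_cochain_def Y_1 split: list.splits)

lemma zero_absorbing_Delta: "zero_absorbing \<Delta>"
  unfolding zero_absorbing_def
proof (intro allI impI)
  fix y and xs :: "('a \<times> 'b) list" assume "0 \<in> set xs"
  then show "\<Delta> y xs = 0"
    by (cases "length xs = 2") (auto simp: Delta_outside length_2_conv Delta_eq zero_prod_def)
qed

lemma zero_absorbing_P: "zero_absorbing \<Pi>"
  unfolding zero_absorbing_def
proof (intro allI impI)
  fix y and xs :: "('a \<times> 'b) list" assume "0 \<in> set xs"
  then show "\<Pi> y xs = 0"
    by (cases "length xs = 1")
      (auto simp: P_cochain_outside length_Suc_conv P_cochain_eq zero_prod_def)
qed

subsection \<open>Degrees\<close>

lemma Delta_in_CY: "\<Delta> \<in> CY scaleD 2"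
  unfolding CY_def
  by (auto simp: Delta_outside linearD_iff Y_2 length_2_conv Delta_eq scaleD less_2_cases_iff)

lemma P_in_CY: "\<Pi> \<in> CY scaleD 1"
  unfolding CY_def
  by (auto simp: P_cochain_outside linearD_iff Y_1 length_Suc_conv P_cochain_eq scaleD)

lemma list_all2_2: "length xs = 2 \<Longrightarrow> list_all2 R bs xs \<longleftrightarrow>
    (\<exists>b b' x x'. bs = [b, b'] \<and> xs = [x, x'] \<and> R b x \<and> R b' x')"
  by (auto simp: length_2_conv list_all2_Cons2)

lemma Delta_in_h: "\<Delta> \<in> h_space sA sM 1"
proof -
  \<comment> \<open>On pairs, \<open>k'\<close> counts the arguments from A and so fixes
    \<open>l'\<close>; on other lists \<Delta> is 0. The three cases settle all conditions of
    bidegree 1|0.\<close>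
  have *: "(k' = 2 \<longrightarrow> snd (\<Delta> y xs) = 0) \<and> (k' = 1 \<longrightarrow> fst (\<Delta> y xs) = 0)
      \<and> (k' \<noteq> 2 \<longrightarrow> k' \<noteq> 1 \<longrightarrow> \<Delta> y xs = 0)" if "xs \<in> mixed k' l'" for k' l' y xs
  proof (cases "length xs = 2")
    case True
    with that show ?thesis
      by (auto simp: mixed_def list_all2_2 Delta_eq zero_prod_def split: if_splits)
  qed (simp add: Delta_outside)
  show ?thesis
    unfolding h_space_def CY_bidegree_def using Delta_in_CY *
    by (auto; fastforce)
qed

lemma P_in_a: "\<Pi> \<in> a_space sA sM 0"
proof -
  \<comment> \<open>The number \<open>l'\<close> of arguments from M decides; the case
    \<open>l' \<noteq> 1\<close> also settles the condition on \<open>mixed (-1) 2\<close>.\<close>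
  have *: "(l' = 1 \<longrightarrow> snd (\<Pi> y xs) = 0) \<and> (l' \<noteq> 1 \<longrightarrow> \<Pi> y xs = 0)"
    if "xs \<in> mixed k' l'" for k' l' y xs
  proof (cases "length xs = 1")
    case True
    with that show ?thesis
      by (auto simp: mixed_def list_all2_Cons2 length_Suc_conv P_cochain_eq zero_prod_def split: if_splits)
  qed (simp add: P_cochain_outside)
  show ?thesis
    unfolding a_space_def CY_bidegree_def using P_in_CY *
    by (auto; fastforce)
qed

lemma zero_in_bidegree: "0 \<in> CY_bidegree sA sM k n"
  by (auto simp: CY_bidegree_def CY_def linearD_iff scaleD zero_prod_def)

lemma candidate_in_L: "(single 1 \<Delta>, single 0 \<Pi>) \<in> L_space sA sM 0"
  using Delta_in_h P_in_a zero_in_bidegree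
  by (auto simp: L_space_def single_def h_space_def a_space_def)

subsection \<open>The iterated brackets with \<open>P\<close>\<close>

lemma MM_Delta_P: "MM 2 (Suc 0) \<Delta> \<Pi> y [x, x'] =
    (if y = Leaf \<or>\<^sub>t cherry
     then (\<mu> (P (snd x)) (fst x') + \<mu> (fst x) (P (snd x')) - P (r (snd x) (fst x')),
           r (snd x) (P (snd x')))
     else if y = cherry \<or>\<^sub>t Leaf
     then (\<mu> (P (snd x)) (fst x') + \<mu> (fst x) (P (snd x')) - P (l (fst x) (snd x')),
           l (P (snd x)) (snd x'))
     else 0)"
  by (auto simp: MM_2_1 Y_2 Delta_eq P_cochain_eq)

text \<open>Both terms of \<open>w\<close> arise twice, once for each order of inserting the two
  copies of P. The A-components of the arguments drop out.\<close>

lemma MM_Delta_P_P: "MM 2 (Suc 0) (MM 2 (Suc 0) \<Delta> \<Pi>) \<Pi> y [x, x'] =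
    (let u = snd x; v = snd x' in
     if y = Leaf \<or>\<^sub>t cherry
     then (let w = \<mu> (P u) (P v) - P (r u (P v)) in (w + w, 0))
     else if y = cherry \<or>\<^sub>t Leaf
     then (let w = \<mu> (P u) (P v) - P (l (P u) v) in (w + w, 0))
     else 0)"
  by (auto simp: MM_2_1[of "MM 2 (Suc 0) \<Delta> \<Pi>"] Y_2 MM_Delta_P P_cochain_eq Let_def
      algebra_simps)

text \<open>The double bracket reads only M-components and has values in A, whereas P has values in
  A and vanishes on A. Hence each of the three terms is 0.\<close>

lemma MM_Delta_P_P_P: "MM 2 (Suc 0) (MM 2 (Suc 0) (MM 2 (Suc 0) \<Delta> \<Pi>) \<Pi>) \<Pi> = 0"
  by (rule ext)+ (auto simp: MM_2_1[of "MM 2 (Suc 0) (MM 2 (Suc 0) \<Delta> \<Pi>) \<Pi>"] Y_2 MM_Delta_P_P P_cochain_eq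
      Let_def zero_prod_def split: list.splits)

lemma iterated_bracket_0: "n \<ge> 3 \<Longrightarrow> ((\<lambda>h. MM 2 (Suc 0) h \<Pi>) ^^ n) \<Delta> = 0"
proof (induction n rule: dec_induct)
  case base
  then show ?case by (simp only: numeral_3_eq_3 funpow.simps id_apply comp_apply MM_Delta_P_P_P)
next
  case (step n)
  then show ?case
    by (simp only: funpow.simps id_apply comp_apply MM_zero_left[OF zero_absorbing_P])
qed

lemma MM_2_1_outside: "y \<notin> Y 2 \<or> length xs \<noteq> 2 \<Longrightarrow> MM 2 (Suc 0) f g y xs = 0"
  by (auto simp: MM_2_1 split: list.splits)

text \<open>Each term of the A-component contains the A-component of an argument, which the
  projection sets to 0.\<close>

lemma proj_MM_Delta_P: "proj_a (single 1 (MM 2 (Suc 0) \<Delta> \<Pi>)) = 0"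
proof (intro ext)
  fix n y as
  show "proj_a (single 1 (MM 2 (Suc 0) \<Delta> \<Pi>)) n y as = 0 n y as"
    by (cases "length as = 2")
      (auto simp: proj_a_def single_def length_2_conv MM_Delta_P zero_prod_def MM_2_1_outside)
qed

lemma rel_averaging_iff: "rel_averaging sA \<mu> sM l r P \<longleftrightarrow>
    proj_a (single 1 (MM 2 (Suc 0) (MM 2 (Suc 0) \<Delta> \<Pi>) \<Pi>)) = 0" (is "_ \<longleftrightarrow> proj_a (single 1 ?G) = 0")
proof
  assume avg: "rel_averaging sA \<mu> sM l r P"
  show "proj_a (single 1 ?G) = 0"
  proof (intro ext)
    fix n y as
    show "proj_a (single 1 ?G) n y as = 0 n y as"
      using avg
      by (cases "length as = 2")
        (auto simp: proj_a_def single_def length_2_conv MM_Delta_P_P zero_prod_def MM_2_1_outside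
          rel_averaging_def Let_def)
  qed
next
  assume 0: "proj_a (single 1 ?G) = 0"
  \<comment> \<open>On arguments already in M, the replacement of arguments made by
    \<open>proj_a\<close> changes nothing.\<close>
  have G: "fst (?G y [(0, u), (0, v)]) = 0" for y u v
  proof -
    have "proj_a (single 1 ?G) 1 y [(0, u), (0, v)] = 0" using 0 by simp
    then show ?thesis by (simp add: proj_a_def zero_prod_def del: One_nat_def)
  qed
  have "\<mu> (P u) (P v) = P (r u (P v))" for u v
    using G[of "Leaf \<or>\<^sub>t cherry" u v] by (simp add: MM_Delta_P_P Let_def A_double)
  moreover have "\<mu> (P u) (P v) = P (l (P u) v)" for u v
    using G[of "cherry \<or>\<^sub>t Leaf" u v] by (simp add: MM_Delta_P_P Let_def A_double)
  ultimately show "rel_averaging sA \<mu> sM l r P"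
    using linear_P by (auto simp: rel_averaging_def)
qed

subsection \<open>The bracket of \<open>\<Delta>\<close> with itself\<close>

lemma circ_Delta_Delta:
  "circ 2 2 1 \<Delta> \<Delta> y [x\<^sub>1, x\<^sub>2, x\<^sub>3] = (if y \<in> Y 3
     then \<Delta> (R_outer 2 1 2 y) [\<Delta> (R_inner 2 1 2 y) [x\<^sub>1, x\<^sub>2], x\<^sub>3] else 0)"
  "circ 2 2 2 \<Delta> \<Delta> y [x\<^sub>1, x\<^sub>2, x\<^sub>3] = (if y \<in> Y 3
     then \<Delta> (R_outer 2 2 2 y) [x\<^sub>1, \<Delta> (R_inner 2 2 2 y) [x\<^sub>2, x\<^sub>3]] else 0)"
  by (auto simp: circ_def numeral_2_eq_2 numeral_3_eq_3)

text \<open>For \<open>i = 1\<close> the outer tree loses leaf 1 and the inner tree leaf 3; for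
  \<open>i = 2\<close> these are leaf 2 and leaf 0.\<close>

lemma R_trees:
  "R_outer 2 1 2 (Leaf \<or>\<^sub>t (Leaf \<or>\<^sub>t cherry)) = Leaf \<or>\<^sub>t cherry"
  "R_inner 2 1 2 (Leaf \<or>\<^sub>t (Leaf \<or>\<^sub>t cherry)) = Leaf \<or>\<^sub>t cherry"
  "R_outer 2 2 2 (Leaf \<or>\<^sub>t (Leaf \<or>\<^sub>t cherry)) = Leaf \<or>\<^sub>t cherry"
  "R_inner 2 2 2 (Leaf \<or>\<^sub>t (Leaf \<or>\<^sub>t cherry)) = Leaf \<or>\<^sub>t cherry"
  "R_outer 2 1 2 (Leaf \<or>\<^sub>t (cherry \<or>\<^sub>t Leaf)) = Leaf \<or>\<^sub>t cherry"
  "R_inner 2 1 2 (Leaf \<or>\<^sub>t (cherry \<or>\<^sub>t Leaf)) = Leaf \<or>\<^sub>t cherry"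
  "R_outer 2 2 2 (Leaf \<or>\<^sub>t (cherry \<or>\<^sub>t Leaf)) = Leaf \<or>\<^sub>t cherry"
  "R_inner 2 2 2 (Leaf \<or>\<^sub>t (cherry \<or>\<^sub>t Leaf)) = cherry \<or>\<^sub>t Leaf"
  "R_outer 2 1 2 (cherry \<or>\<^sub>t cherry) = Leaf \<or>\<^sub>t cherry"
  "R_inner 2 1 2 (cherry \<or>\<^sub>t cherry) = cherry \<or>\<^sub>t Leaf"
  "R_outer 2 2 2 (cherry \<or>\<^sub>t cherry) = cherry \<or>\<^sub>t Leaf"
  "R_inner 2 2 2 (cherry \<or>\<^sub>t cherry) = Leaf \<or>\<^sub>t cherry"
  "R_outer 2 1 2 ((Leaf \<or>\<^sub>t cherry) \<or>\<^sub>t Leaf) = cherry \<or>\<^sub>t Leaf"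
  "R_inner 2 1 2 ((Leaf \<or>\<^sub>t cherry) \<or>\<^sub>t Leaf) = Leaf \<or>\<^sub>t cherry"
  "R_outer 2 2 2 ((Leaf \<or>\<^sub>t cherry) \<or>\<^sub>t Leaf) = cherry \<or>\<^sub>t Leaf"
  "R_inner 2 2 2 ((Leaf \<or>\<^sub>t cherry) \<or>\<^sub>t Leaf) = cherry \<or>\<^sub>t Leaf"
  "R_outer 2 1 2 ((cherry \<or>\<^sub>t Leaf) \<or>\<^sub>t Leaf) = cherry \<or>\<^sub>t Leaf"
  "R_inner 2 1 2 ((cherry \<or>\<^sub>t Leaf) \<or>\<^sub>t Leaf) = cherry \<or>\<^sub>t Leaf"
  "R_outer 2 2 2 ((cherry \<or>\<^sub>t Leaf) \<or>\<^sub>t Leaf) = cherry \<or>\<^sub>t Leaf"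
  "R_inner 2 2 2 ((cherry \<or>\<^sub>t Leaf) \<or>\<^sub>t Leaf) = cherry \<or>\<^sub>t Leaf"
  by (simp_all add: tree_simps)

text \<open>Every tree gives associativity in the A-component. In the M-component, the two trees
  with a leaf left of the root give the right module axiom, the two with a leaf right of the root
  the left module axiom, and \<open>cherry \<or>\<^sub>t cherry\<close> the compatibility of the
  actions. The converse evaluates one tree of each kind.\<close>

lemma algebra_bimodule_iff: "assoc_algebra sA \<mu> \<and> bimodule sA \<mu> sM l r \<longleftrightarrow>
    (\<forall>y xs. circ 2 2 1 \<Delta> \<Delta> y xs = circ 2 2 2 \<Delta> \<Delta> y xs)"
proof
  assume ax: "assoc_algebra sA \<mu> \<and> bimodule sA \<mu> sM l r"
  show "\<forall>y xs. circ 2 2 1 \<Delta> \<Delta> y xs = circ 2 2 2 \<Delta> \<Delta> y xs"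
  proof (intro allI)
    fix y and xs :: "('a \<times> 'b) list"
    show "circ 2 2 1 \<Delta> \<Delta> y xs = circ 2 2 2 \<Delta> \<Delta> y xs"
    proof (cases "y \<in> Y 3 \<and> length xs = 3")
      case True
      then obtain x\<^sub>1 x\<^sub>2 x\<^sub>3 where "xs = [x\<^sub>1, x\<^sub>2, x\<^sub>3]" by (auto simp: length_3_conv)
      with True ax show ?thesis
        by (auto simp: circ_Delta_Delta[unfolded One_nat_def] Y_3 R_trees[unfolded One_nat_def]
            Delta_eq assoc_algebra_def bimodule_def)
    next
      case False
      then show ?thesis by (auto simp: circ_def)
    qed
  qed
next
  assume "\<forall>y xs. circ 2 2 1 \<Delta> \<Delta> y xs = circ 2 2 2 \<Delta> \<Delta> y xs"
  then have eq: "circ 2 2 1 \<Delta> \<Delta> y xs = circ 2 2 2 \<Delta> \<Delta> y xs" for y xs by blast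
  have "\<mu> (\<mu> a b) c = \<mu> a (\<mu> b c) \<and> r (r u b) c = r u (\<mu> b c)" for a b c u
    using eq[of "Leaf \<or>\<^sub>t (Leaf \<or>\<^sub>t cherry)" "[(a, u), (b, 0), (c, 0)]"]
    by (simp add: circ_Delta_Delta Y_3 R_trees Delta_eq del: One_nat_def)
  moreover have "r (l a u) c = l a (r u c)" for a c u
    using eq[of "cherry \<or>\<^sub>t cherry" "[(a, 0), (0, u), (c, 0)]"]
    by (simp add: circ_Delta_Delta Y_3 R_trees Delta_eq del: One_nat_def)
  moreover have "l (\<mu> a b) u = l a (l b u)" for a b u
    using eq[of "(cherry \<or>\<^sub>t Leaf) \<or>\<^sub>t Leaf" "[(a, 0), (b, 0), (0, u)]"]
    by (simp add: circ_Delta_Delta Y_3 R_trees Delta_eq del: One_nat_def)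
  ultimately show "assoc_algebra sA \<mu> \<and> bimodule sA \<mu> sM l r"
    using bilinear_mu bilinear_l bilinear_r by (simp add: assoc_algebra_def bimodule_def)
qed

lemma MM_Delta_Delta_eq_0_iff:
  "MM 2 2 (- \<Delta>) \<Delta> = 0 \<longleftrightarrow> (\<forall>y xs. circ 2 2 1 \<Delta> \<Delta> y xs = circ 2 2 2 \<Delta> \<Delta> y xs)"
proof -
  have "MM 2 2 (- \<Delta>) \<Delta> y xs = 0 \<longleftrightarrow> circ 2 2 1 \<Delta> \<Delta> y xs = circ 2 2 2 \<Delta> \<Delta> y xs" for y xs
  proof -
    have "\<Delta> y [- a, b] = - \<Delta> y [a, b]" "\<Delta> y [a, - b] = - \<Delta> y [a, b]" for y a b
      by (simp_all add: Delta_eq zero_prod_def)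
    then show ?thesis
      by (simp only: MM_2_2 Let_def neg_equal_0_iff_equal D_double right_minus_eq)
  qed
  then show ?thesis by (simp add: fun_eq_iff)
qed

subsection \<open>The Maurer--Cartan series\<close>

lemma linf_candidate:
  assumes "k \<ge> 2"
  shows "linf k (replicate k (single 1 \<Delta>, single 0 \<Pi>)) =
    (if k = 2 then single 2 (MM 2 2 (- \<Delta>) \<Delta>) else 0,
     if k = 3 then \<Sum>j<3::nat. proj_a (single 1 (MM 2 (Suc 0) (MM 2 (Suc 0) \<Delta> \<Pi>) \<Pi>)) else 0)"
proof -
  \<comment> \<open>With \<Delta> taken from one entry, \<open>k - 1\<close> copies of P remain: one
    bracket is killed by the projection, two survive, and three or more give 0.\<close>
  consider "k = 2" | "k = 3" | "k - 1 \<ge> 3" using assms by linarith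
  then show ?thesis
    using linf_replicate[OF zero_absorbing_Delta zero_absorbing_P assms] proj_MM_Delta_P
    by cases (simp_all add: iterated_bracket_0[unfolded numeral_2_eq_2] numeral_2_eq_2)
qed

lemma maurer_cartan_iff:
  "maurer_cartan (L_scale sA sM) (L_space sA sM) linf (single 1 \<Delta>, single 0 \<Pi>) \<longleftrightarrow>
    MM 2 2 (- \<Delta>) \<Delta> = 0 \<and> proj_a (single 1 (MM 2 (Suc 0) (MM 2 (Suc 0) \<Delta> \<Pi>) \<Pi>)) = 0"
    (is "_ \<longleftrightarrow> ?B = 0 \<and> ?G = 0")
proof -
  let ?l = "\<lambda>k. linf k (replicate k (single 1 \<Delta>, single 0 \<Pi>))"
  let ?t = "\<lambda>k. L_scale sA sM (1 / fact k) (?l k)"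
  let ?K = "{k. 1 \<le> k \<and> ?l k \<noteq> 0}"
  have sub: "?K \<subseteq> {2, 3}"
  proof
    fix k assume k: "k \<in> ?K"
    then have "k \<ge> 2" by (simp add: linf_def split: if_splits)
    with k show "k \<in> {2, 3}" by (auto simp: linf_candidate[unfolded One_nat_def] zero_prod_def split: if_splits)
  qed
  have L0: "L_scale sA sM c 0 = 0" for c
    by (simp add: L_scale_def scaleD fun_eq_iff zero_prod_def)
  \<comment> \<open>The series runs only over nonvanishing operations; the indices added here
    contribute 0.\<close>
  have "(\<Sum>k\<in>?K. ?t k) = (\<Sum>k\<in>{2, 3}. ?t k)"
    by (rule sum.mono_neutral_left) (use sub L0 in auto)
  also have "\<dots> = ?t 2 + ?t 3" by simp
  \<comment> \<open>The binary term has only an \<hh>-part and the ternary term only an \<aa>-part,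
    so they cannot cancel.\<close>
  also have "\<dots> = (L_scale sA sM (1 / 2) (single 2 ?B, 0)) +
      (L_scale sA sM (1 / 6) (0, \<Sum>j<3::nat. ?G))"
    by (simp add: linf_candidate[unfolded One_nat_def] fact_numeral)
  also have "\<dots> = ((\<lambda>n y as. scaleD (1 / 2) (single 2 ?B n y as)),
      (\<lambda>n y as. scaleD (1 / 6) (?G n y as + ?G n y as + ?G n y as)))"
    by (simp add: L_scale_def fun_eq_iff numeral_3_eq_3 scaleD zero_prod_def)
  finally have sum: "(\<Sum>k\<in>?K. ?t k) = \<dots>" .
  have pair_eq_0: "(f, g) = (0 :: ('a, 'b) shifted_sum) \<longleftrightarrow>
      (\<forall>n y as. f n y as = 0) \<and> (\<forall>n y as. g n y as = 0)" for f g
    by (auto simp: zero_prod_def fun_eq_iff)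
  \<comment> \<open>The scalars 1/2 and 1/6 are nonzero, and \<open>D_triple\<close> removes the
    factor 3.\<close>
  have "(\<Sum>k\<in>?K. ?t k) = 0 \<longleftrightarrow> (\<forall>n y as. single 2 ?B n y as = 0) \<and> (\<forall>n y as. ?G n y as = 0)"
    unfolding sum pair_eq_0 by (simp add: D_triple)
  also have "\<dots> \<longleftrightarrow> ?B = 0 \<and> ?G = 0"
    by (auto simp: fun_eq_iff single_def)
  finally show ?thesis
    using candidate_in_L finite_subset[OF sub] by (simp add: maurer_cartan_def)
qed

end

theorem theorem5p8:
  fixes sA :: "'k::field_char_0 \<Rightarrow> 'a::ab_group_add \<Rightarrow> 'a"
    and sM :: "'k \<Rightarrow> 'b::ab_group_add \<Rightarrow> 'b"
    and \<mu> :: "'a \<Rightarrow> 'a \<Rightarrow> 'a"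
    and l\<^sub>M :: "'a \<Rightarrow> 'b \<Rightarrow> 'b"
    and r\<^sub>M :: "'b \<Rightarrow> 'a \<Rightarrow> 'b"
    and P :: "'b \<Rightarrow> 'a"
  assumes "vector_space sA" and "vector_space sM"
    and "bilinear_map sA sA sA \<mu>"
    and "bilinear_map sA sM sM l\<^sub>M"
    and "bilinear_map sM sA sM r\<^sub>M"
    and "Vector_Spaces.linear sM sA P"
  shows "assoc_algebra sA \<mu> \<and> bimodule sA \<mu> sM l\<^sub>M r\<^sub>M \<and> rel_averaging sA \<mu> sM l\<^sub>M r\<^sub>M P \<longleftrightarrow>
    maurer_cartan (L_scale sA sM) (L_space sA sM) linf
      (single 1 (Delta \<mu> l\<^sub>M r\<^sub>M), single 0 (P_cochain P))"
proof -
  interpret averaging_candidate sA sM \<mu> l\<^sub>M r\<^sub>M P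
    by (rule averaging_candidate.intro[OF assms])
  show ?thesis
    using algebra_bimodule_iff rel_averaging_iff MM_Delta_Delta_eq_0_iff maurer_cartan_iff by blast
qed

end
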